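(* Let $n\ge 1$, let $\mathbb{F}$ be an arbitrary field, and let $C\subseteq\mathbb{R}^n$ be a full-dimensional pointed convex polyhedral cone generated by a finite set $G\subseteq\mathbb{Z}^n$. Let $R_{\mathbb{F}}=\mathbb{F}[C^\vee\cap\mathbb{Z}^n]$ be the toric $\mathbb{F}$-algebra associated to $C$. Let $\mathcal{B}$ be a finite generating set for the semigroup $C^\vee\cap\mathbb{Z}^n$, let $v_G=\sum_{v\in G}v\in\mathbb{Z}^n$, and set $$D:=\max_{w\in\mathcal{B}}\,(w\bullet v_G)\in\mathbb{Z}_{>0}.$$ Then for all integers $r>0$ and all monomial prime ideals $P$ of $R_{\mathbb{F}}$, $$P^{(Dr)}\subseteq P^{(D(r-1)+1)}\subseteq P^r .$$
   Context: Here $\bullet$ is the dot product on $\mathbb{R}^n$. The cone generated by $G$ is $C=\{\sum_{v\in G}a_v v : a_v\in\mathbb{R}_{\ge0}\}$; full-dimensional means that $C$ spans $\mathbb{R}^n$, and pointed means that $C$ contains no line through the origin. The dual cone is $C^\vee=\{w\in\mathbb{R}^n : w\bullet v\ge 0\text{ for all }v\in C\}$. The toric algebra $R_{\mathbb{F}}=\mathbb{F}[C^\vee\cap\mathbb{Z}^n]$ is the semigroup algebra of the semigroup $C^\vee\cap\mathbb{Z}^n$ (under addition, with identity $0$); it has the $\mathbb{F}$-basis of monomials $\{\chi^\ell : \ell\in C^\vee\cap\mathbb{Z}^n\}$ with $\chi^{\ell}\chi^{\ell'}=\chi^{\ell+\ell'}$. An ideal of $R_{\mathbb{F}}$ is monomial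 if it is generated by a subset of these monomials. For a prime ideal $P$ of a Noetherian domain $R$ and an integer $a\ge1$, the symbolic power is $P^{(a)}=P^aR_P\cap R=\{f\in R : uf\in P^a\text{ for some }u\in R\setminus P\}$. *)

theory Defs
  imports
    "HOL-Analysis.Analysis"
    "HOL-Library.Poly_Mapping"
    "HOL-Algebra.Ideal_Product"
begin

section \<open>Cones and lattice points\<close>

definition integer_lattice :: "(real ^ 'n) set" where
  "integer_lattice = {x. \<forall>i. x $ i \<in> \<int>}"

text \<open>Only meaningful for finite \<open>G\<close>, since sums over infinite sets are \<open>0\<close> by convention.\<close>

definition cone_generated :: "(real ^ 'n) set \<Rightarrow> (real ^ 'n) set" where
  "cone_generated G = {(\<Sum>v\<in>G. a v *\<^sub>R v) | a :: real ^ 'n \<Rightarrow> real. \<forall>v\<in>G. 0 \<le> a v}"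

definition full_dimensional :: "(real ^ 'n) set \<Rightarrow> bool" where
  "full_dimensional C \<longleftrightarrow> span C = UNIV"

definition pointed :: "(real ^ 'n) set \<Rightarrow> bool" where
  "pointed C \<longleftrightarrow> \<not> (\<exists>x. x \<noteq> 0 \<and> range (\<lambda>t. t *\<^sub>R x) \<subseteq> C)"

definition dual_cone :: "(real ^ 'n) set \<Rightarrow> (real ^ 'n) set" where
  "dual_cone C = {w. \<forall>v\<in>C. 0 \<le> w \<bullet> v}"

definition dual_semigroup :: "(real ^ 'n) set \<Rightarrow> (real ^ 'n) set" where
  "dual_semigroup C = dual_cone C \<inter> integer_lattice"

text \<open>The semigroups here contain \<open>0\<close>, so generation is as a monoid: the empty sum is allowed,
  and a generating set need not contain \<open>0\<close> (but may).\<close>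

definition generates_semigroup :: "(real ^ 'n) set \<Rightarrow> (real ^ 'n) set \<Rightarrow> bool" where
  "generates_semigroup B S \<longleftrightarrow> S = {(\<Sum>w\<in>B. real (k w) *\<^sub>R w) | k :: real ^ 'n \<Rightarrow> nat. True}"

section \<open>The toric algebra\<close>

text \<open>Multiplication of finitely supported functions \<open>'a \<Rightarrow>\<^sub>0 'f\<close> is convolution, so this type is the
  semigroup algebra of all of \<open>'a\<close>; the algebra of a submonoid \<open>S\<close> is cut out by the support.\<close>

definition semigroup_algebra :: "'a::comm_monoid_add set \<Rightarrow> ('a \<Rightarrow>\<^sub>0 'f::field) ring" where
  "semigroup_algebra S =
     \<lparr>carrier = {f. Poly_Mapping.keys f \<subseteq> S}, mult = (*), one = 1, zero = 0, add = (+)\<rparr>"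

definition toric_algebra :: "(real ^ 'n) set \<Rightarrow> ((real ^ 'n) \<Rightarrow>\<^sub>0 'f::field) ring" where
  "toric_algebra C = semigroup_algebra (dual_semigroup C)"

definition chi :: "'a \<Rightarrow> ('a \<Rightarrow>\<^sub>0 'f::field)" where
  "chi l = Poly_Mapping.single l 1"

definition monomial_ideal :: "(real ^ 'n) set \<Rightarrow> ((real ^ 'n) \<Rightarrow>\<^sub>0 'f::field) set \<Rightarrow> bool" where
  "monomial_ideal C I \<longleftrightarrow>
     (\<exists>M \<subseteq> dual_semigroup C. I = genideal (toric_algebra C) (chi ` M))"

section \<open>Ordinary and symbolic powers\<close>

primrec ideal_power :: "('a, 'b) ring_scheme \<Rightarrow> 'a set \<Rightarrow> nat \<Rightarrow> 'a set" where
  "ideal_power R I 0 = carrier R"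
| "ideal_power R I (Suc k) = ideal_prod R (ideal_power R I k) I"

text \<open>The contraction of \<open>P\<^sup>a R\<^sub>P\<close> to \<open>R\<close>, with denominators cleared.\<close>

definition symbolic_power :: "('a, 'b) ring_scheme \<Rightarrow> 'a set \<Rightarrow> nat \<Rightarrow> 'a set" where
  "symbolic_power R P a =
     {f \<in> carrier R. \<exists>u \<in> carrier R - P. u \<otimes>\<^bsub>R\<^esub> f \<in> ideal_power R P a}"

section \<open>Well-formedness\<close>

text \<open>The locales \<open>ideal\<close> and \<open>primeideal\<close> include the ring axioms, so it matters
  that the toric algebra satisfies them.\<close>

lemma semigroup_algebra_cring:
  fixes S :: "'a::comm_monoid_add set"
  assumes z: "0 \<in> S" and a: "\<And>x y. x \<in> S \<Longrightarrow> y \<in> S \<Longrightarrow> x + y \<in> S"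
  shows "cring (semigroup_algebra S :: ('a \<Rightarrow>\<^sub>0 'f::field) ring)"
proof -
  have m: "Poly_Mapping.keys (f * g) \<subseteq> S"
    if "Poly_Mapping.keys f \<subseteq> S" "Poly_Mapping.keys g \<subseteq> S" for f g :: "'a \<Rightarrow>\<^sub>0 'f"
    using keys_mult[of f g] that a by blast
  have p: "Poly_Mapping.keys (f + g) \<subseteq> S"
    if "Poly_Mapping.keys f \<subseteq> S" "Poly_Mapping.keys g \<subseteq> S" for f g :: "'a \<Rightarrow>\<^sub>0 'f"
    using Poly_Mapping.keys_add[of f g] that by blast
  have n: "Poly_Mapping.keys (- f) \<subseteq> S" if "Poly_Mapping.keys f \<subseteq> S" for f :: "'a \<Rightarrow>\<^sub>0 'f"
    using that by (auto simp: in_keys_iff)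
  show ?thesis
  proof (rule cringI)
    show "abelian_group (semigroup_algebra S :: ('a \<Rightarrow>\<^sub>0 'f) ring)"
    proof (rule abelian_groupI)
      fix x :: "'a \<Rightarrow>\<^sub>0 'f"
      assume "x \<in> carrier (semigroup_algebra S)"
      then show "\<exists>y\<in>carrier (semigroup_algebra S).
          y \<oplus>\<^bsub>semigroup_algebra S\<^esub> x = \<zero>\<^bsub>semigroup_algebra S\<^esub>"
        by (intro bexI[of _ "- x"]) (auto simp: semigroup_algebra_def dest: n)
    qed (use p in \<open>auto simp: semigroup_algebra_def algebra_simps\<close>)
    show "comm_monoid (semigroup_algebra S :: ('a \<Rightarrow>\<^sub>0 'f) ring)"
      by (rule comm_monoidI) (use m z in \<open>auto simp: semigroup_algebra_def algebra_simps\<close>)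
  qed (auto simp: semigroup_algebra_def algebra_simps)
qed

lemma toric_algebra_cring: "cring (toric_algebra C)"
  unfolding toric_algebra_def
  by (rule semigroup_algebra_cring)
     (auto simp: dual_semigroup_def dual_cone_def integer_lattice_def inner_add_left)

lemma chi_mult: "chi l * chi l' = chi (l + l')"
  by (simp add: chi_def mult_single)

end

theory Submission
  imports Defs
begin

text \<open>Let \<open>P\<close> be a monomial prime. The exponents \<open>l\<close> with \<open>chi l \<notin> P\<close> form a face of the semigroup
  \<open>S\<close>, and this face is the zero set on \<open>S\<close> of \<open>\<psi> l = l \<bullet> z\<close>, where \<open>z\<close> is the sum of the
  generators in \<open>G\<close> orthogonal to the face. As \<open>\<psi>\<close> is integral on \<open>S\<close>, all exponents occurring in
  \<open>P\<^sup>a\<close> have \<open>\<psi> \<ge> a\<close>. This persists for the symbolic power: if \<open>u \<notin> P\<close>, then the minimum of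
  \<open>\<psi>\<close> on the exponents of \<open>u\<close> is \<open>0\<close>, and the minimum over \<open>u f\<close> is the sum of the minima. Conversely
  \<open>0 \<le> \<psi> w \<le> w \<bullet> v\<^sub>G \<le> D\<close> for \<open>w \<in> B\<close>, so an exponent with \<open>\<psi> l > D (r - 1)\<close> needs at least \<open>r\<close>
  summands \<open>w \<in> B\<close> outside the face, whence \<open>chi l \<in> P\<^sup>r\<close>.\<close>

section \<open>Semigroup algebras\<close>

lemma semigroup_algebra_simps [simp]:
  "carrier (semigroup_algebra S) = {f. Poly_Mapping.keys f \<subseteq> S}"
  "f \<otimes>\<^bsub>semigroup_algebra S\<^esub> g = f * g"
  "f \<oplus>\<^bsub>semigroup_algebra S\<^esub> g = f + g"
  "\<zero>\<^bsub>semigroup_algebra S\<^esub> = 0"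
  "\<one>\<^bsub>semigroup_algebra S\<^esub> = 1"
  by (simp_all add: semigroup_algebra_def)

lemma keys_chi [simp]: "Poly_Mapping.keys (chi l :: 'a \<Rightarrow>\<^sub>0 'f::field) = {l}"
  by (simp add: chi_def)

text \<open>Scalars appear as the constants \<open>Poly_Mapping.single 0 c\<close>, which lie in the
  algebra itself as soon as \<open>0 \<in> S\<close>; ideals therefore absorb the
  coefficients.\<close>

lemma poly_mapping_sum_chi:
  fixes f :: "'a::comm_monoid_add \<Rightarrow>\<^sub>0 'f::field"
  shows "(\<Sum>k\<in>Poly_Mapping.keys f. Poly_Mapping.single 0 (Poly_Mapping.lookup f k) * chi k) = f"
proof (rule poly_mapping_eqI)
  fix l
  have "Poly_Mapping.lookup (\<Sum>k\<in>Poly_Mapping.keys f.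
        Poly_Mapping.single 0 (Poly_Mapping.lookup f k) * chi k) l
      = (\<Sum>k\<in>Poly_Mapping.keys f. if k = l then Poly_Mapping.lookup f k else 0)"
    by (simp add: chi_def mult_single lookup_sum lookup_single when_def)
  also have "\<dots> = Poly_Mapping.lookup f l"
    by (simp add: sum.delta in_keys_iff)
  finally show "Poly_Mapping.lookup (\<Sum>k\<in>Poly_Mapping.keys f.
        Poly_Mapping.single 0 (Poly_Mapping.lookup f k) * chi k) l
      = Poly_Mapping.lookup f l" .
qed

text \<open>Reduces membership to monomials. Applied to \<open>P^r\<close> it proves the
  containment; applied to \<open>P\<close>, read contrapositively, it gives an element outside
  \<open>P\<close> a monomial outside \<open>P\<close>.\<close>

lemma in_ideal_if_chi_keys:
  fixes f :: "'a::comm_monoid_add \<Rightarrow>\<^sub>0 'f::field"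
  assumes "ideal I (semigroup_algebra S)" and "0 \<in> S"
    and "\<And>k. k \<in> Poly_Mapping.keys f \<Longrightarrow> chi k \<in> I"
  shows "f \<in> I"
proof -
  interpret ideal I "semigroup_algebra S" by fact
  have "(\<Sum>k\<in>K. Poly_Mapping.single 0 (Poly_Mapping.lookup f k) * chi k) \<in> I"
    if "finite K" "K \<subseteq> Poly_Mapping.keys f" for K
    using that
  proof (induction K rule: finite_induct)
    case empty
    then show ?case using additive_subgroup.zero_closed[OF is_additive_subgroup] by simp
  next
    case (insert k K)
    have "Poly_Mapping.single 0 (Poly_Mapping.lookup f k) * chi k \<in> I"
      using I_l_closed[of "chi k" "Poly_Mapping.single 0 (Poly_Mapping.lookup f k)"] insert.prems assms(2,3)
      by auto
    then show ?case
      using insert additive_subgroup.a_closed[OF is_additive_subgroup, of "Poly_Mapping.single 0 (Poly_Mapping.lookup f k) * chi k"] by auto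
  qed
  from this[of "Poly_Mapping.keys f"] show ?thesis
    by (simp add: poly_mapping_sum_chi)
qed

lemma ideal_of_keys_subset:
  fixes S T :: "'a::comm_monoid_add set"
  assumes "0 \<in> S" and "\<And>x y. x \<in> S \<Longrightarrow> y \<in> S \<Longrightarrow> x + y \<in> S"
    and "T \<subseteq> S" and T: "\<And>x y. x \<in> T \<Longrightarrow> y \<in> S \<Longrightarrow> x + y \<in> T"
  shows "ideal {f :: 'a \<Rightarrow>\<^sub>0 'f::field. Poly_Mapping.keys f \<subseteq> T} (semigroup_algebra S)"
    (is "ideal ?I ?R")
proof -
  interpret cring ?R
    using assms(1,2) by (rule semigroup_algebra_cring)
  have minus: "\<ominus>\<^bsub>?R\<^esub> f = - f" if "Poly_Mapping.keys f \<subseteq> T" for f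
    using that assms(3) by (intro minus_equality) (auto simp: in_keys_iff)
  have mult: "f * g \<in> ?I" if "f \<in> ?I" "Poly_Mapping.keys g \<subseteq> S" for f g :: "'a \<Rightarrow>\<^sub>0 'f"
    using keys_mult[of f g] that T by blast
  show ?thesis
  proof (rule idealI)
    show "subgroup ?I (add_monoid ?R)"
    proof (rule add.subgroupI)
      show "?I \<subseteq> carrier ?R" using assms(3) by auto
      show "?I \<noteq> {}" by (auto intro: exI[of _ 0])
      show "\<ominus>\<^bsub>?R\<^esub> f \<in> ?I" if "f \<in> ?I" for f
        using that by (auto simp: minus in_keys_iff)
      show "f \<oplus>\<^bsub>?R\<^esub> g \<in> ?I" if "f \<in> ?I" "g \<in> ?I" for f g
        using that Poly_Mapping.keys_add[of f g] by auto
    qed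
  qed (use mult ring_axioms in \<open>auto simp: mult.commute\<close>)
qed

text \<open>The elements supported on \<open>M + S\<close> form an ideal containing the generators,
  so each exponent of \<open>f\<close> is some \<open>m + s\<close>, and
  \<open>chi m * chi s\<close> lies in the ideal.\<close>

lemma chi_keys_in_monomial_ideal:
  fixes S M :: "'a::comm_monoid_add set" and f :: "'a \<Rightarrow>\<^sub>0 'f::field"
  assumes S: "0 \<in> S" "\<And>x y. x \<in> S \<Longrightarrow> y \<in> S \<Longrightarrow> x + y \<in> S"
    and M: "M \<subseteq> S"
    and f: "f \<in> genideal (semigroup_algebra S) (chi ` M)"
    and k: "k \<in> Poly_Mapping.keys f"
  shows "chi k \<in> genideal (semigroup_algebra S) (chi ` M :: ('a \<Rightarrow>\<^sub>0 'f) set)"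
proof -
  let ?R = "semigroup_algebra S :: ('a \<Rightarrow>\<^sub>0 'f) ring"
  let ?T = "{m + s | m s. m \<in> M \<and> s \<in> S}"
  interpret cring ?R
    using S by (rule semigroup_algebra_cring)
  have carr: "chi ` M \<subseteq> carrier ?R" using M by auto
  have "ideal {g :: 'a \<Rightarrow>\<^sub>0 'f. Poly_Mapping.keys g \<subseteq> ?T} ?R"
    using S M by (intro ideal_of_keys_subset) (auto, metis add.assoc)
  moreover have "M \<subseteq> ?T"
  proof
    fix m assume "m \<in> M"
    with S(1) have "m + 0 \<in> ?T" by blast
    then show "m \<in> ?T" by simp
  qed
  then have "chi ` M \<subseteq> {g :: 'a \<Rightarrow>\<^sub>0 'f. Poly_Mapping.keys g \<subseteq> ?T}" by auto
  ultimately have "genideal ?R (chi ` M) \<subseteq> {g. Poly_Mapping.keys g \<subseteq> ?T}"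
    by (rule genideal_minimal)
  with f k obtain m s where ms: "m \<in> M" "s \<in> S" "k = m + s" by blast
  interpret I: ideal "genideal ?R (chi ` M)" ?R
    using carr by (rule genideal_ideal)
  have "chi m \<in> genideal ?R (chi ` M)"
    using genideal_self[OF carr] ms(1) by blast
  from I.I_r_closed[OF this, of "chi s"] show ?thesis
    using ms by (simp add: chi_mult)
qed

text \<open>For \<open>\<psi> = 0\<close> this is the absence of zero divisors. Among the pairs of \<open>\<psi>\<close>-minimal exponents
  the one maximizing the norm of the sum cannot be cancelled: if \<open>a + b = a' + b'\<close>, then
  \<open>a + b'\<close> and \<open>a' + b\<close> have midpoint \<open>a + b\<close> and no larger norm, so they are equal.\<close>

lemma no_cancellation_at_minimum:
  fixes f g :: "'a::real_inner \<Rightarrow>\<^sub>0 'f::field" and \<psi> :: "'a \<Rightarrow> real"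
  assumes add: "\<And>x y. \<psi> (x + y) = \<psi> x + \<psi> y"
    and k: "k \<in> Poly_Mapping.keys f" and l: "l \<in> Poly_Mapping.keys g"
  shows "\<exists>m\<in>Poly_Mapping.keys (f * g). \<psi> m \<le> \<psi> k + \<psi> l"
proof -
  define A where "A = {a \<in> Poly_Mapping.keys f. \<forall>a'\<in>Poly_Mapping.keys f. \<psi> a \<le> \<psi> a'}"
  define B where "B = {b \<in> Poly_Mapping.keys g. \<forall>b'\<in>Poly_Mapping.keys g. \<psi> b \<le> \<psi> b'}"
  have min: "{x \<in> X. \<forall>y\<in>X. \<psi> x \<le> \<psi> y} \<noteq> {}" if "finite X" "X \<noteq> {}" for X
    using ex_is_arg_min_if_finite[OF that, of \<psi>] by (auto simp: is_arg_min_linorder)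
  have "A \<noteq> {}" "B \<noteq> {}" "finite A" "finite B"
    using min[of "Poly_Mapping.keys f"] min[of "Poly_Mapping.keys g"] k l
    unfolding A_def B_def by fastforce+
  then have "finite (A \<times> B)" "A \<times> B \<noteq> {}" by auto
  from ex_is_arg_min_if_finite[OF this, of "\<lambda>(a, b). - norm (a + b)"]
  obtain a b where ab: "a \<in> A" "b \<in> B"
    and max: "\<And>a' b'. a' \<in> A \<Longrightarrow> b' \<in> B \<Longrightarrow> norm (a' + b') \<le> norm (a + b)"
    by (auto simp: is_arg_min_linorder)
  have unique: "a' = a" if "a' \<in> Poly_Mapping.keys f" "b' \<in> Poly_Mapping.keys g"
    and eq: "a + b = a' + b'" for a' b'
  proof -
    have "\<psi> a \<le> \<psi> a'" "\<psi> b \<le> \<psi> b'" "\<psi> a + \<psi> b = \<psi> a' + \<psi> b'"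
      using ab that unfolding A_def B_def by (auto simp flip: add)
    \<comment> \<open>Two lower bounds with equal sums are equalities, so the competing pair is
      again minimal and subject to \<open>max\<close>.\<close>
    then have "\<psi> a' = \<psi> a" "\<psi> b' = \<psi> b" by auto
    then have "a' \<in> A" "b' \<in> B"
      using ab that unfolding A_def B_def by auto
    define p q where "p = a + b'" and "q = a' + b"
    define s where "s = a + b"
    have "norm p \<le> norm s" "norm q \<le> norm s"
      using max ab \<open>a' \<in> A\<close> \<open>b' \<in> B\<close> unfolding p_def q_def s_def by blast+
    then have "p \<bullet> p \<le> s \<bullet> s" "q \<bullet> q \<le> s \<bullet> s"
      by (simp_all add: norm_le)
    moreover have "p + q = s + s"
      using eq by (simp add: p_def q_def s_def algebra_simps)
    then have "(p + q) \<bullet> (p + q) = 4 * (s \<bullet> s)"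
      by (simp add: inner_add_left inner_add_right)
    \<comment> \<open>Parallelogram law: the squared norm of \<open>p - q\<close> is twice those of
      \<open>p\<close> and \<open>q\<close> minus that of \<open>p + q\<close>, hence at most
      \<open>4 - 4 = 0\<close> times that of \<open>s\<close>.\<close>
    ultimately have "(p - q) \<bullet> (p - q) \<le> 0"
      by (simp add: inner_add_left inner_add_right inner_diff_left inner_diff_right inner_commute)
    then have "(p - q) \<bullet> (p - q) = 0" using inner_ge_zero[of "p - q"] by linarith
    then have "p = q" by simp
    with \<open>p + q = s + s\<close> have "2 *\<^sub>R q = 2 *\<^sub>R s" by (simp add: scaleR_2)
    then have "q = s" by simp
    then show "a' = a" by (simp add: q_def s_def)
  qed
  have "Poly_Mapping.lookup (f * g) (a + b)
      = (\<Sum>x. Poly_Mapping.lookup f x * Poly_Mapping.lookup g (a + b - x))"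
  proof -
    have "(Poly_Mapping.lookup g y when a + b = x + y)
        = (Poly_Mapping.lookup g y when y = a + b - x)" for x y
      by (auto simp: when_def algebra_simps)
    then show ?thesis by (simp add: lookup_mult)
  qed
  \<comment> \<open>By \<open>unique\<close>, the convolution at \<open>a + b\<close> collapses to a
    single term.\<close>
  also have "\<dots> = (\<Sum>x. Poly_Mapping.lookup f a * Poly_Mapping.lookup g b when x = a)"
  proof (rule Sum_any.cong)
    fix x
    show "Poly_Mapping.lookup f x * Poly_Mapping.lookup g (a + b - x)
        = (Poly_Mapping.lookup f a * Poly_Mapping.lookup g b when x = a)"
      using unique[of x "a + b - x"] by (cases "x = a") (auto simp: in_keys_iff)
  qed
  also have "\<dots> = Poly_Mapping.lookup f a * Poly_Mapping.lookup g b" by simp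
  also have "\<dots> \<noteq> 0"
    using ab by (auto simp: A_def B_def in_keys_iff)
  finally have "a + b \<in> Poly_Mapping.keys (f * g)" by (simp add: in_keys_iff)
  moreover have "\<psi> (a + b) \<le> \<psi> k + \<psi> l"
    using ab k l by (auto simp: add A_def B_def intro: add_mono)
  ultimately show ?thesis by blast
qed

section \<open>Powers of ideals\<close>

lemma (in ring) ideal_ideal_power:
  assumes "ideal I R"
  shows "ideal (ideal_power R I a) R"
  by (induction a) (auto intro: assms ideal_prod_is_ideal oneideal)

lemma (in ring) ideal_power_antimono:
  assumes "ideal I R" and "a \<le> b"
  shows "ideal_power R I b \<subseteq> ideal_power R I a"
  using assms(2)
proof (induction rule: dec_induct)
  case (step b)
  then show ?case
    using ideal_prod_inter[OF ideal_ideal_power[OF assms(1)] assms(1)] by auto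
qed simp

lemma (in ring) symbolic_power_antimono:
  assumes "ideal I R" and "a \<le> b"
  shows "symbolic_power R I b \<subseteq> symbolic_power R I a"
  using ideal_power_antimono[OF assms] unfolding symbolic_power_def by blast

text \<open>Each further factor from \<open>P\<close> raises the bound by 1, since exponents add in
  products, and a sum has only exponents of its summands. The power 0 is the whole algebra, where
  \<open>\<psi>\<close> is nonnegative.\<close>

lemma keys_ideal_power_ge:
  fixes \<psi> :: "'a::comm_monoid_add \<Rightarrow> real" and P :: "('a \<Rightarrow>\<^sub>0 'f::field) set"
  assumes add: "\<And>x y. \<psi> (x + y) = \<psi> x + \<psi> y"
    and S: "\<And>k. k \<in> S \<Longrightarrow> 0 \<le> \<psi> k"
    and P: "\<And>f k. f \<in> P \<Longrightarrow> k \<in> Poly_Mapping.keys f \<Longrightarrow> 1 \<le> \<psi> k"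
    and f: "f \<in> ideal_power (semigroup_algebra S) P a"
    and k: "k \<in> Poly_Mapping.keys f"
  shows "real a \<le> \<psi> k"
  using f k
proof (induction a arbitrary: f k)
  case 0
  then show ?case using S by auto
next
  case (Suc a)
  from Suc.prems(1) have "f \<in> ideal_prod (semigroup_algebra S)
      (ideal_power (semigroup_algebra S) P a) P" by simp
  then have "\<forall>k\<in>Poly_Mapping.keys f. real (Suc a) \<le> \<psi> k"
  proof (induction rule: ideal_prod.induct)
    case (prod i j)
    show ?case
    proof
      fix k assume "k \<in> Poly_Mapping.keys (i \<otimes>\<^bsub>semigroup_algebra S\<^esub> j)"
      then obtain x y where "k = x + y" "x \<in> Poly_Mapping.keys i" "y \<in> Poly_Mapping.keys j"
        using keys_mult[of i j] by auto
      then show "real (Suc a) \<le> \<psi> k"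
        using Suc.IH[OF prod(1)] P[OF prod(2)] by (fastforce simp: add)
    qed
  next
    case (sum s t)
    then show ?case using Poly_Mapping.keys_add[of s t] by auto
  qed
  with Suc.prems(2) show ?case by blast
qed

section \<open>Lattice points of the dual cone\<close>

lemma generator_in_cone:
  assumes "finite G" and "v \<in> G"
  shows "v \<in> cone_generated G"
proof -
  have "(\<Sum>u\<in>G. (if u = v then 1 else 0) *\<^sub>R u) = (\<Sum>u\<in>G. if u = v then u else 0)"
    by (rule sum.cong) auto
  also have "\<dots> = v"
    using assms by (simp add: sum.delta)
  finally show ?thesis
    unfolding cone_generated_def by (auto intro!: exI[of _ "\<lambda>u. if u = v then 1 else 0"])
qed

lemma dual_cone_cone_generated:
  assumes "finite G"
  shows "dual_cone (cone_generated G) = {w. \<forall>v\<in>G. 0 \<le> w \<bullet> v}"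
proof
  show "dual_cone (cone_generated G) \<subseteq> {w. \<forall>v\<in>G. 0 \<le> w \<bullet> v}"
    using generator_in_cone[OF assms] by (auto simp: dual_cone_def)
  show "{w. \<forall>v\<in>G. 0 \<le> w \<bullet> v} \<subseteq> dual_cone (cone_generated G)"
    by (auto simp: dual_cone_def cone_generated_def inner_sum_right intro!: sum_nonneg)
qed

lemma zero_in_dual_semigroup: "0 \<in> dual_semigroup C"
  by (simp add: dual_semigroup_def dual_cone_def integer_lattice_def)

lemma add_in_dual_semigroup:
  "x \<in> dual_semigroup C \<Longrightarrow> y \<in> dual_semigroup C \<Longrightarrow> x + y \<in> dual_semigroup C"
  by (auto simp: dual_semigroup_def dual_cone_def integer_lattice_def inner_add_left)

lemma inner_integer_lattice:
  "x \<in> integer_lattice \<Longrightarrow> y \<in> integer_lattice \<Longrightarrow> x \<bullet> y \<in> \<int>"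
  by (auto simp: integer_lattice_def inner_vec_def)

lemma sum_integer_lattice:
  "(\<And>v. v \<in> A \<Longrightarrow> f v \<in> integer_lattice) \<Longrightarrow> (\<Sum>v\<in>A. f v) \<in> integer_lattice"
  by (auto simp: integer_lattice_def)

lemma Ints_pos_ge_1: "x \<in> \<int> \<Longrightarrow> 0 < x \<Longrightarrow> 1 \<le> (x::real)"
  by (auto elim!: Ints_cases)

lemma combination_in_semigroup:
  assumes "generates_semigroup B S"
  shows "(\<Sum>w\<in>B. real (k w) *\<^sub>R w) \<in> S"
proof -
  have "S = {\<Sum>w\<in>B. real (k w) *\<^sub>R w |k. True}"
    using assms by (simp add: generates_semigroup_def)
  then show ?thesis by blast
qed

lemma generator_in_semigroup:
  assumes "finite B" and "generates_semigroup B S" and "w \<in> B"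
  shows "w \<in> S"
proof -
  have "(\<Sum>u\<in>B. real (if u = w then 1 else 0) *\<^sub>R u) = (\<Sum>u\<in>B. if u = w then u else 0)"
    by (rule sum.cong) auto
  also have "\<dots> = w"
    using assms by (simp add: sum.delta)
  finally show ?thesis
    using combination_in_semigroup[OF assms(2), of "\<lambda>u. if u = w then 1 else 0"] by simp
qed

text \<open>A positive sum has a positive term; one copy of the corresponding generator can be
  removed without leaving the semigroup.\<close>

lemma generated_semigroup_split:
  assumes "finite B" and "generates_semigroup B S" and "l \<in> S" and "0 < l \<bullet> z"
  shows "\<exists>w\<in>B. 0 < w \<bullet> z \<and> l - w \<in> S"
proof -
  obtain k where l: "l = (\<Sum>w\<in>B. real (k w) *\<^sub>R w)"
    using assms(2,3) unfolding generates_semigroup_def by auto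
  have "l \<bullet> z = (\<Sum>w\<in>B. real (k w) * (w \<bullet> z))"
    by (simp add: l inner_sum_left)
  with assms(4) have "\<not> (\<Sum>w\<in>B. real (k w) * (w \<bullet> z)) \<le> 0" by simp
  then obtain w where w: "w \<in> B" "0 < real (k w) * (w \<bullet> z)"
    using sum_nonpos[of B "\<lambda>w. real (k w) * (w \<bullet> z)"] not_le by blast
  then have "0 < k w" "0 < w \<bullet> z"
    by (auto simp: zero_less_mult_iff)
  have "(\<Sum>u\<in>B. real ((k(w := k w - 1)) u) *\<^sub>R u)
      = (\<Sum>u\<in>B. real (k u) *\<^sub>R u - (if u = w then u else 0))"
    using \<open>0 < k w\<close> by (intro sum.cong) (auto simp: of_nat_diff algebra_simps)
  also have "\<dots> = l - w"
    using w assms(1) by (simp add: l sum_subtractf sum.delta)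
  finally have "l - w \<in> S"
    using combination_in_semigroup[OF assms(2), of "k(w := k w - 1)"] by simp
  with w \<open>0 < w \<bullet> z\<close> show ?thesis by blast
qed

section \<open>Lattice points strictly positive on the cone generators\<close>

text \<open>Rounding \<open>N a\<close> down coordinatewise changes its inner product with
  \<open>v\<close> by at most the l1 norm of \<open>v\<close>, while
  \<open>N (a \<bullet> v)\<close> exceeds any bound for large \<open>N\<close>.\<close>

lemma exists_lattice_point_positive:
  fixes a :: "real ^ 'n"
  assumes "finite H" and "0 < b" and "\<And>v. v \<in> H \<Longrightarrow> b < a \<bullet> v"
  shows "\<exists>w\<in>integer_lattice. \<forall>v\<in>H. 0 < w \<bullet> v"
proof -
  \<comment> \<open>\<open>K\<close> dominates the l1 norms of all \<open>v \<in> H\<close> at once,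
    so one \<open>N\<close> serves for all of them.\<close>
  define K where "K = (\<Sum>v\<in>H. \<Sum>i\<in>UNIV. \<bar>v $ i\<bar>)"
  obtain N :: nat where N: "K < real N * b"
    using ex_less_of_nat_mult[OF \<open>0 < b\<close>] by blast
  define w :: "real ^ 'n" where "w = (\<chi> i. of_int \<lfloor>real N * a $ i\<rfloor>)"
  have "0 < w \<bullet> v" if "v \<in> H" for v
  proof -
    have "real N * (a \<bullet> v) - w \<bullet> v = (\<Sum>i\<in>UNIV. (real N * a $ i - w $ i) * v $ i)"
      by (simp add: inner_vec_def sum_distrib_left sum_subtractf algebra_simps)
    also have "\<dots> \<le> (\<Sum>i\<in>UNIV. \<bar>v $ i\<bar>)"
    proof (rule sum_mono)
      fix i
      have "\<bar>real N * a $ i - w $ i\<bar> \<le> 1"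
        unfolding w_def by simp linarith
      then have "\<bar>(real N * a $ i - w $ i) * v $ i\<bar> \<le> 1 * \<bar>v $ i\<bar>"
        unfolding abs_mult by (rule mult_right_mono) simp
      then show "(real N * a $ i - w $ i) * v $ i \<le> \<bar>v $ i\<bar>" by linarith
    qed
    also have "\<dots> \<le> K"
      unfolding K_def using assms(1) that
      by (intro member_le_sum[of v H "\<lambda>v. \<Sum>i\<in>UNIV. \<bar>v $ i\<bar>"]) (auto intro: sum_nonneg)
    also note N
    also have "real N * b \<le> real N * (a \<bullet> v)"
      using assms(3)[OF that] by (intro mult_left_mono) auto
    finally show ?thesis by simp
  qed
  moreover have "w \<in> integer_lattice"
    by (simp add: integer_lattice_def w_def)
  ultimately show ?thesis by blast
qed

text \<open>A convex combination equal to 0 makes the negative of some nonzero generator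
  \<open>u\<close> a nonnegative combination of generators, so the line through \<open>u\<close>
  lies in the cone.\<close>

lemma pointed_imp_0_notin_convex_hull:
  assumes "finite G" and "pointed (cone_generated G)"
  shows "0 \<notin> convex hull (G - {0})"
proof
  assume "0 \<in> convex hull (G - {0})"
  then obtain c where c: "\<And>v. v \<in> G - {0} \<Longrightarrow> 0 \<le> c v" "sum c (G - {0}) = 1"
    "(\<Sum>v\<in>G - {0}. c v *\<^sub>R v) = 0"
    using assms(1) by (auto simp: convex_hull_finite)
  obtain u where u: "u \<in> G - {0}" "c u \<noteq> 0"
    using c(2) by (metis sum.neutral zero_neq_one)
  with c(1) have "0 < c u" by (metis order_le_less)
  have sum0: "(\<Sum>v\<in>G. c v *\<^sub>R v) = 0"
    using c(3) assms(1) by (cases "0 \<in> G") (simp_all add: sum.remove[of G 0])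
  have "t *\<^sub>R u \<in> cone_generated G" for t
  proof -
    \<comment> \<open>Adding \<open>s\<close> times the relation leaves the vector
      \<open>t *\<^sub>R u\<close> unchanged, and \<open>s * c u = \<bar>t\<bar>\<close> offsets a
      negative \<open>t\<close>.\<close>
    define s where "s = \<bar>t\<bar> / c u"
    have "s * c u + t \<ge> 0" "s \<ge> 0"
      using \<open>0 < c u\<close> by (auto simp: s_def)
    \<comment> \<open>The coefficient at 0 is reset because the sign of \<open>c 0\<close> is not
      controlled.\<close>
    define d where "d v = (if v = 0 then 0 else s * c v + (if v = u then t else 0))" for v
    have "\<forall>v\<in>G. 0 \<le> d v"
      using c(1) \<open>s * c u + t \<ge> 0\<close> \<open>s \<ge> 0\<close> by (auto simp: d_def)
    moreover have "(\<Sum>v\<in>G. d v *\<^sub>R v) = (\<Sum>v\<in>G. s *\<^sub>R (c v *\<^sub>R v) + (if v = u then t *\<^sub>R v else 0))"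
      by (rule sum.cong) (auto simp: d_def algebra_simps)
    then have "(\<Sum>v\<in>G. d v *\<^sub>R v) = t *\<^sub>R u"
      using u assms(1) by (simp add: sum.distrib sum0 flip: scaleR_scaleR scaleR_sum_right)
    ultimately show ?thesis
      unfolding cone_generated_def by force
  qed
  with u assms(2) show False
    unfolding pointed_def by auto
qed

text \<open>This makes \<open>D\<close> positive. Pointedness yields a hyperplane separating 0 from
  the nonzero generators, and rounding its normal gives a lattice point; full dimension provides a
  nonzero generator.\<close>

lemma dual_semigroup_meets_positive:
  fixes G :: "(real ^ 'n) set"
  assumes "finite G" and "full_dimensional (cone_generated G)" and "pointed (cone_generated G)"
  shows "\<exists>l\<in>dual_semigroup (cone_generated G). 0 < l \<bullet> (\<Sum>v\<in>G. v)"
proof -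
  have "closed (convex hull (G - {0}))"
    using assms(1) by (simp add: compact_imp_closed finite_imp_compact_convex_hull)
  from separating_hyperplane_closed_0[OF convex_convex_hull this
      pointed_imp_0_notin_convex_hull[OF assms(1,3)]]
  obtain a b where "0 < b" and ab: "\<forall>x\<in>convex hull (G - {0}). b < a \<bullet> x"
    by blast
  have "b < a \<bullet> v" if "v \<in> G - {0}" for v
    using ab hull_inc[OF that, of convex] by blast
  with \<open>0 < b\<close> obtain w where w: "w \<in> integer_lattice" "\<And>v. v \<in> G - {0} \<Longrightarrow> 0 < w \<bullet> v"
    using exists_lattice_point_positive[of "G - {0}" b a] assms(1) by auto
  have nonneg: "0 \<le> w \<bullet> v" if "v \<in> G" for v
    using w(2)[of v] that by (cases "v = 0") auto
  have "\<exists>v\<in>G. v \<noteq> 0"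
  proof (rule ccontr)
    assume "\<not> ?thesis"
    then have "cone_generated G \<subseteq> {0}"
      by (auto simp: cone_generated_def intro!: sum.neutral)
    then have "span (cone_generated G) \<subseteq> {0}"
      by (metis span_insert_0 span_empty span_mono)
    \<comment> \<open>Index types are nonempty, so the space has a unit vector.\<close>
    with assms(2) have "axis undefined 1 \<in> {0 :: real ^ 'n}"
      by (auto simp: full_dimensional_def)
    then show False by (simp add: axis_eq_0_iff)
  qed
  then obtain v where v: "v \<in> G" "0 < w \<bullet> v" using w(2) by auto
  have "0 < (\<Sum>v\<in>G. w \<bullet> v)"
    using sum_pos2[OF assms(1) v(1), of "(\<bullet>) w"] v(2) nonneg by simp
  then show ?thesis
    using w(1) nonneg dual_cone_cone_generated[OF assms(1)]
    by (intro bexI[of _ w]) (auto simp: dual_semigroup_def inner_sum_right)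
qed

section \<open>Monomial primes\<close>

text \<open>If \<open>e\<close> is an exponent in the face that is positive on every generator not vanishing on the
  face, and \<open>l\<close> is orthogonal to the remaining generators, then \<open>N e - l\<close> lies in the semigroup for
  large \<open>N\<close>, so \<open>l\<close> is in the face as well.\<close>

lemma monomial_prime_face:
  fixes G :: "(real ^ 'n) set" and P :: "((real ^ 'n) \<Rightarrow>\<^sub>0 'f::field) set"
  assumes "finite G" and C: "C = cone_generated G"
    and prime: "primeideal P (toric_algebra C)"
  shows "\<exists>H\<subseteq>G. \<forall>l\<in>dual_semigroup C. chi l \<in> P \<longleftrightarrow> 0 < l \<bullet> (\<Sum>v\<in>H. v)"
proof -
  let ?S = "dual_semigroup C"
  interpret primeideal P "semigroup_algebra ?S"
    using prime by (simp add: toric_algebra_def)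
  define F where "F = {l \<in> ?S. chi l \<notin> P}"
  define H where "H = {v \<in> G. \<forall>l\<in>F. l \<bullet> v = 0}"
  have S: "l \<in> ?S \<longleftrightarrow> l \<in> integer_lattice \<and> (\<forall>v\<in>G. 0 \<le> l \<bullet> v)" for l
    by (auto simp: dual_semigroup_def C dual_cone_cone_generated[OF assms(1)])
  have finite: "finite H" using assms(1) by (simp add: H_def)
  have "0 \<in> F"
  proof -
    have "chi 0 \<notin> P"
      using I_notcarr one_imp_carrier by (auto simp: chi_def)
    then show ?thesis by (simp add: F_def zero_in_dual_semigroup)
  qed
  have F_add: "x + y \<in> F" if "x \<in> F" "y \<in> F" for x y
    using that I_prime[of "chi x" "chi y"] by (auto simp: F_def add_in_dual_semigroup chi_mult)
  have F_sum: "(\<Sum>i\<in>A. g i) \<in> F" if "\<And>i. i \<in> A \<Longrightarrow> g i \<in> F" for A and g :: "real ^ 'n \<Rightarrow> _"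
    using that by (induction A rule: infinite_finite_induct) (auto simp: \<open>0 \<in> F\<close> F_add)
  have F_scale: "real N *\<^sub>R x \<in> F" if "x \<in> F" for x N
    using that by (induction N) (auto simp: \<open>0 \<in> F\<close> F_add scaleR_left_distrib)
  have "\<forall>v\<in>G - H. \<exists>l\<in>F. l \<bullet> v \<noteq> 0"
    by (auto simp: H_def)
  then obtain p where p: "\<And>v. v \<in> G - H \<Longrightarrow> p v \<in> F" "\<And>v. v \<in> G - H \<Longrightarrow> p v \<bullet> v \<noteq> 0"
    by metis
  \<comment> \<open>One witness for each generator outside \<open>H\<close>; all witnesses are
    nonnegative on \<open>G\<close>, so nothing cancels.\<close>
  define e where "e = (\<Sum>v\<in>G - H. p v)"
  have "e \<in> F" unfolding e_def using p(1) by (rule F_sum)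
  have e_pos: "0 < e \<bullet> v" if "v \<in> G - H" for v
  proof -
    have nonneg: "0 \<le> p u \<bullet> v" if "u \<in> G - H" for u
      using p(1)[OF that] \<open>v \<in> G - H\<close> by (auto simp: F_def S)
    then have "0 < p v \<bullet> v" using p(2) that by force
    then show ?thesis
      unfolding e_def inner_sum_left using assms(1) that nonneg
      by (intro sum_pos2[of "G - H" v]) auto
  qed
  have face: "l \<in> F" if l: "l \<in> ?S" "\<And>v. v \<in> H \<Longrightarrow> l \<bullet> v = 0" for l
  proof -
    \<comment> \<open>The sum of the rounded ratios dominates each of them.\<close>
    define N where "N = (\<Sum>v\<in>G - H. nat \<lceil>(l \<bullet> v) / (e \<bullet> v)\<rceil>)"
    have "l \<bullet> v \<le> real N * (e \<bullet> v)" if "v \<in> G - H" for v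
    proof -
      have "(l \<bullet> v) / (e \<bullet> v) \<le> real (nat \<lceil>(l \<bullet> v) / (e \<bullet> v)\<rceil>)" by linarith
      also have "nat \<lceil>(l \<bullet> v) / (e \<bullet> v)\<rceil> \<le> N"
        unfolding N_def using assms(1) that by (intro member_le_sum) auto
      finally show ?thesis using e_pos[OF that] by (simp add: divide_le_eq)
    qed
    moreover have "l \<bullet> v \<le> real N * (e \<bullet> v)" if "v \<in> H" for v
      using that l(2) \<open>e \<in> F\<close> by (auto simp: H_def)
    ultimately have "\<forall>v\<in>G. 0 \<le> (real N *\<^sub>R e - l) \<bullet> v"
      by (auto simp: inner_diff_left)
    moreover have "real N *\<^sub>R e - l \<in> integer_lattice"
      using l(1) \<open>e \<in> F\<close> by (auto simp: F_def S integer_lattice_def)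
    ultimately have "real N *\<^sub>R e - l \<in> ?S" by (simp add: S)
    \<comment> \<open>Multiplying \<open>chi l\<close> by \<open>chi (N e - l)\<close> would put
      \<open>chi (N e)\<close> into \<open>P\<close>, but \<open>N e\<close> stays in
      \<open>F\<close>.\<close>
    then have "chi (real N *\<^sub>R e) \<in> P" if "chi l \<in> P"
      using I_r_closed[OF that, of "chi (real N *\<^sub>R e - l)"] by (simp add: chi_mult)
    moreover have "chi (real N *\<^sub>R e) \<notin> P"
      using F_scale[OF \<open>e \<in> F\<close>] by (simp add: F_def)
    ultimately show ?thesis using l(1) by (auto simp: F_def)
  qed
  have "chi l \<in> P \<longleftrightarrow> 0 < l \<bullet> (\<Sum>v\<in>H. v)" if l: "l \<in> ?S" for l
  proof -
    have nonneg: "\<forall>v\<in>H. 0 \<le> l \<bullet> v" using l by (auto simp: S H_def)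
    have "0 < l \<bullet> (\<Sum>v\<in>H. v) \<longleftrightarrow> (\<exists>v\<in>H. l \<bullet> v \<noteq> 0)"
      unfolding inner_sum_right
      using sum_nonneg[of H "\<lambda>v. l \<bullet> v"] sum_nonneg_eq_0_iff[OF finite, of "\<lambda>v. l \<bullet> v"] nonneg
      by (metis order_less_le)
    also have "\<dots> \<longleftrightarrow> l \<notin> F"
      using face[OF l] by (auto simp: H_def)
    finally show ?thesis using l by (simp add: F_def)
  qed
  then show ?thesis by (intro exI[of _ H]) (auto simp: H_def)
qed

text \<open>Generators with \<open>w \<bullet> z > 0\<close> are split off one at a time. Each
  contributes a factor in \<open>P\<close> and lowers \<open>l \<bullet> z\<close> by at most
  \<open>D\<close>, so the bound allows \<open>r\<close> factors.\<close>

lemma chi_in_ideal_power: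
  fixes P :: "((real ^ 'n) \<Rightarrow>\<^sub>0 'f::field) set" and D :: nat
  assumes B: "finite B" "generates_semigroup B S"
    and P: "\<And>l. l \<in> S \<Longrightarrow> 0 < l \<bullet> z \<Longrightarrow> chi l \<in> P"
    and zero: "0 \<in> S"
    and D: "\<And>w. w \<in> B \<Longrightarrow> w \<bullet> z \<le> real D"
    and l: "l \<in> S" "real D * (real r - 1) < l \<bullet> z"
  shows "chi l \<in> ideal_power (semigroup_algebra S) P r"
proof (cases r)
  case 0
  then show ?thesis using l by simp
next
  case (Suc q)
  \<comment> \<open>With \<open>r = q + 1\<close> the strict bound at \<open>q = 0\<close> is just
    positivity, and the last factor is \<open>chi l\<close> itself.\<close>
  have "chi l \<in> ideal_power (semigroup_algebra S) P (Suc q)"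
    if "l \<in> S" "real D * real q < l \<bullet> z" for l
    using that
  proof (induction q arbitrary: l)
    case 0
    \<comment> \<open>The first power is by definition the product of the unit ideal with
      \<open>P\<close>.\<close>
    have "chi l = 1 * (chi l :: (real ^ 'n) \<Rightarrow>\<^sub>0 'f)" by simp
    then show ?case
      using zero ideal_prod.prod[of 1 "carrier (semigroup_algebra S)" "chi l" P "semigroup_algebra S"]
        P[of l] 0 by simp
  next
    case (Suc q)
    have "0 < l \<bullet> z" using Suc.prems(2) by (metis le_less_trans of_nat_0_le_iff of_nat_mult)
    then obtain w where w: "w \<in> B" "0 < w \<bullet> z" "l - w \<in> S"
      using generated_semigroup_split[OF B Suc.prems(1)] by blast
    have "real D * real q < (l - w) \<bullet> z"
      using Suc.prems(2) D[OF w(1)] by (simp add: inner_diff_left algebra_simps)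
    from Suc.IH[OF w(3) this]
    have "chi (l - w) * chi w \<in> ideal_power (semigroup_algebra S) P (Suc (Suc q))"
      using ideal_prod.prod[of "chi (l - w)" _ "chi w" P "semigroup_algebra S"]
        P[OF generator_in_semigroup[OF B w(1)] w(2)] by simp
    then show ?case by (simp add: chi_mult)
  qed
  then show ?thesis using l Suc by simp
qed

section \<open>The two containments for monomial primes\<close>

theorem theorem1p1:
  fixes G B C :: "(real ^ 'n) set" and v\<^sub>G :: "real ^ 'n"
  assumes "finite G" and "G \<subseteq> integer_lattice"
    and "C = cone_generated G"
    and "full_dimensional C" and "pointed C"
    and "finite B" and "generates_semigroup B (dual_semigroup C)"
    and "v\<^sub>G = (\<Sum>v\<in>G. v)"
  shows "\<exists>D::nat. real D = Max ((\<lambda>w. w \<bullet> v\<^sub>G) ` B) \<and> D > 0 \<and>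
    (\<forall>r::nat. \<forall>P :: ((real ^ 'n) \<Rightarrow>\<^sub>0 'f::field) set.
       r > 0 \<longrightarrow> primeideal P (toric_algebra C) \<longrightarrow> monomial_ideal C P \<longrightarrow>
         symbolic_power (toric_algebra C) P (D * r)
           \<subseteq> symbolic_power (toric_algebra C) P (D * (r - 1) + 1) \<and>
         symbolic_power (toric_algebra C) P (D * (r - 1) + 1)
           \<subseteq> ideal_power (toric_algebra C) P r)"
proof -
  let ?S = "dual_semigroup C"
  let ?M = "Max ((\<lambda>w. w \<bullet> v\<^sub>G) ` B)"
  note gen = assms(6,7)
  have S: "l \<in> ?S \<longleftrightarrow> l \<in> integer_lattice \<and> (\<forall>v\<in>G. 0 \<le> l \<bullet> v)" for l
    by (auto simp: dual_semigroup_def assms(3) dual_cone_cone_generated[OF assms(1)])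
  have B_S: "w \<in> ?S" if "w \<in> B" for w
    using generator_in_semigroup[OF gen that] .
  obtain w where w: "w \<in> B" "0 < w \<bullet> v\<^sub>G"
    using dual_semigroup_meets_positive[OF assms(1)] generated_semigroup_split[OF gen] assms(3,4,5,8)
    by metis
  have le_M: "u \<bullet> v\<^sub>G \<le> ?M" if "u \<in> B" for u
    using assms(6) that by (intro Max_ge) auto
  \<comment> \<open>The maximum is attained at a lattice point, hence is an integer.\<close>
  have "?M \<in> (\<lambda>w. w \<bullet> v\<^sub>G) ` B"
    using assms(6) w(1) by (intro Max_in) auto
  then have "?M \<in> \<int>"
    using B_S assms(2) unfolding assms(8) S
    by (auto intro!: inner_integer_lattice sum_integer_lattice)
  moreover have "0 < ?M" using w le_M by fastforce
  ultimately obtain D :: nat where D: "real D = ?M"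
    by (metis Ints_cases less_imp_le of_int_0_le_iff of_int_of_nat_eq zero_le_imp_eq_int)
  have "0 < D" using D \<open>0 < ?M\<close> by simp
  have main: "symbolic_power (toric_algebra C) P (D * r)
           \<subseteq> symbolic_power (toric_algebra C) P (D * (r - 1) + 1) \<and>
         symbolic_power (toric_algebra C) P (D * (r - 1) + 1)
           \<subseteq> ideal_power (toric_algebra C) P r"
    if "0 < r" and prime: "primeideal P (toric_algebra C)" and mono: "monomial_ideal C P"
    for r and P :: "((real ^ 'n) \<Rightarrow>\<^sub>0 'f) set"
  proof
    interpret primeideal P "semigroup_algebra ?S"
      using prime by (simp add: toric_algebra_def)
    have "D * (r - 1) + 1 \<le> D * r"
      using \<open>0 < r\<close> \<open>0 < D\<close> by (cases r) auto
    then show "symbolic_power (toric_algebra C) P (D * r)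
           \<subseteq> symbolic_power (toric_algebra C) P (D * (r - 1) + 1)"
      unfolding toric_algebra_def by (rule symbolic_power_antimono[OF is_ideal])
    obtain H where "H \<subseteq> G" and chi_P: "\<And>l. l \<in> ?S \<Longrightarrow> chi l \<in> P \<longleftrightarrow> 0 < l \<bullet> (\<Sum>v\<in>H. v)"
      using monomial_prime_face[OF assms(1,3) prime] by blast
    define z where "z = (\<Sum>v\<in>H. v)"
    have nonneg: "0 \<le> l \<bullet> z" if "l \<in> ?S" for l
      using that \<open>H \<subseteq> G\<close> by (auto simp: z_def inner_sum_right S intro!: sum_nonneg)
    have int: "l \<bullet> z \<in> \<int>" if "l \<in> ?S" for l
      using that \<open>H \<subseteq> G\<close> assms(2) unfolding z_def S
      by (auto intro!: inner_integer_lattice sum_integer_lattice)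
    have le_D: "u \<bullet> z \<le> real D" if "u \<in> B" for u
    proof -
      \<comment> \<open>\<open>z\<close> is a partial sum of \<open>v\<^sub>G\<close>, and the
        omitted terms pair nonnegatively with \<open>u\<close>.\<close>
      have "u \<bullet> z \<le> u \<bullet> v\<^sub>G"
        using B_S[OF that] \<open>H \<subseteq> G\<close> assms(1) unfolding z_def assms(8) inner_sum_right S
        by (intro sum_mono2) auto
      then show ?thesis using le_M[OF that] D by simp
    qed
    have keys_P: "chi k \<in> P" if "f \<in> P" "k \<in> Poly_Mapping.keys f" for f k
      using mono that chi_keys_in_monomial_ideal[OF zero_in_dual_semigroup add_in_dual_semigroup]
      unfolding monomial_ideal_def toric_algebra_def by blast
    have keys_S: "k \<in> ?S" if "f \<in> P" "k \<in> Poly_Mapping.keys f" for f k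
      using Icarr[OF that(1)] that(2) by auto
    \<comment> \<open>Membership in \<open>P\<close> only gives positivity; integrality improves it
      to 1.\<close>
    have ge_1: "1 \<le> k \<bullet> z" if "f \<in> P" "k \<in> Poly_Mapping.keys f" for f k
      using Ints_pos_ge_1[OF int[OF keys_S[OF that]]] keys_P[OF that] chi_P[OF keys_S[OF that]]
      by (simp add: z_def)
    show "symbolic_power (toric_algebra C) P (D * (r - 1) + 1) \<subseteq> ideal_power (toric_algebra C) P r"
    proof
      fix f assume "f \<in> symbolic_power (toric_algebra C) P (D * (r - 1) + 1)"
      then obtain u where f: "Poly_Mapping.keys f \<subseteq> ?S" and u: "Poly_Mapping.keys u \<subseteq> ?S" "u \<notin> P"
        and uf: "u * f \<in> ideal_power (semigroup_algebra ?S) P (D * (r - 1) + 1)"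
        by (auto simp: symbolic_power_def toric_algebra_def)
      obtain k where k: "k \<in> Poly_Mapping.keys u" "chi k \<notin> P"
        using in_ideal_if_chi_keys[OF is_ideal zero_in_dual_semigroup] u(2) by blast
      with u(1) chi_P nonneg have k0: "k \<bullet> z = 0"
        unfolding z_def by (metis order_less_le subsetD)
      have "chi l \<in> ideal_power (semigroup_algebra ?S) P r" if l: "l \<in> Poly_Mapping.keys f" for l
      proof -
        \<comment> \<open>The exponent \<open>k\<close> lies in the face and adds nothing, so the
          bound on exponents of \<open>u * f\<close> passes to \<open>l\<close>.\<close>
        obtain m where m: "m \<in> Poly_Mapping.keys (u * f)" "m \<bullet> z \<le> k \<bullet> z + l \<bullet> z"
          using no_cancellation_at_minimum[of "\<lambda>x. x \<bullet> z", OF inner_add_left k(1) l] by blast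
        have "real (D * (r - 1) + 1) \<le> m \<bullet> z"
          using keys_ideal_power_ge[of "\<lambda>x. x \<bullet> z", OF inner_add_left nonneg ge_1 uf m(1)] .
        then have "real (D * (r - 1) + 1) \<le> l \<bullet> z"
          using m(2) k0 by simp
        \<comment> \<open>The summand 1 supplies the strict inequality that splitting off
          \<open>r\<close> factors needs.\<close>
        moreover have "real (D * (r - 1) + 1) = real D * (real r - 1) + 1"
          using \<open>0 < r\<close> by (simp add: of_nat_diff)
        ultimately have "real D * (real r - 1) < l \<bullet> z" by linarith
        with f l show ?thesis
          using chi_P unfolding z_def [symmetric]
          by (intro chi_in_ideal_power[OF gen _ zero_in_dual_semigroup le_D]) auto
      qed
      then show "f \<in> ideal_power (toric_algebra C) P r"
        unfolding toric_algebra_def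
        by (rule in_ideal_if_chi_keys[OF ideal_ideal_power[OF is_ideal] zero_in_dual_semigroup])
    qed
  qed
  show ?thesis
    using D \<open>0 < D\<close> main by (intro exI[of _ D]) blast
qed

end
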